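(* Let $D$ be a multipartite tournament with a directed cycle, the sink elimination index $\zeta(D)\ge 1$, the sink sequence $(W_0,\ldots,W_{\zeta(D)})$, and the digraph sequence $(D_0,\ldots,D_{\zeta(D)})$ associated with the sink sequence. For a vertex $u\in V(D_{\zeta(D)})$, suppose that there exist a $(u,w_1)$-directed walk $Q_1$ of Type 1 and a $(u,w_2)$-directed walk $Q_2$ of Type 2 for some vertices $w_1,w_2\in\bigcup_{i=0}^{\zeta(D)-1}W_i$. Then there exists a positive integer $N$ such that there is a $(u,w)$-directed walk of length $\ell$ for each vertex $w\in\bigcup_{i=0}^{\zeta(D)-1}W_i$ and any integer $\ell\ge N$.
   Context: All digraphs are finite, and the underlying graph of each digraph is simple (no loops, no multiple arcs, no directed cycles of length $2$). A multipartite tournament is an orientation of a complete $k$-partite graph (with $k$ nonempty partite sets) for some integer $k\ge 2$. A $(u,w)$-directed walk is a directed walk from $u$ to $w$. A directed hole in $D$ is a directed cycle of length at least $4$ in $D$ that is an induced subdigraph of $D$. A directed walk in $D$ is of Type 1 if it contains three vertices which induce a directed cycle of length $3$ in $D$, and of Type 2 if it contains four vertices which induce a directed hole of length $4$ in $D$. Sink sequence: a sink is a vertex of outdegree zero. Let $D_0=D$, and for each $i$ let $W_i$ be the set of sinks of $D_i$; if $W_i=V(D_i)$ or $W_i=\emptyset$, stop and put $\zeta(D)=i$; otherwise let $D_{i+1}=D_i-W_i$ (delete the vertices in $W_i$) and continue. The number $\zeta(D)$ is the sink elimination index of $D$, $(W_0,\ldots,W_{\zeta(D)})$ is the sink sequence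 of $D$, and $(D_0,\ldots,D_{\zeta(D)})$ is the digraph sequence associated with the sink sequence. *)

theory Defs
  imports "Graph_Theory.Graph_Theory" "HOL-Library.Disjoint_Sets"
begin

text \<open>
  The locale predicate \<^const>\<open>digraph\<close> already provides finiteness and excludes loops and
  parallel arcs; only directed cycles of length 2 remain to be ruled out.
\<close>

definition oriented_graph :: "('a,'b) pre_digraph \<Rightarrow> bool" where
  "oriented_graph D \<longleftrightarrow> digraph D \<and> (\<forall>u v. u \<rightarrow>\<^bsub>D\<^esub> v \<longrightarrow> \<not> v \<rightarrow>\<^bsub>D\<^esub> u)"

text \<open>
  Undirected graphs are represented as symmetric digraphs, as in the library.
\<close>

definition complete_multipartite_graph :: "'a set set \<Rightarrow> 'a pair_pre_digraph" where
  "complete_multipartite_graph P =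
     \<lparr> pverts = \<Union>P, parcs = {(u,v). \<exists>A\<in>P. \<exists>B\<in>P. A \<noteq> B \<and> u \<in> A \<and> v \<in> B} \<rparr>"

text \<open>
  \<^const>\<open>mk_symmetric\<close> yields the underlying graph of a digraph, and \<^const>\<open>partition_on\<close>
  makes the partite sets nonempty and pairwise disjoint.
\<close>

definition multipartite_tournament :: "('a,'b) pre_digraph \<Rightarrow> bool" where
  "multipartite_tournament D \<longleftrightarrow> oriented_graph D \<and>
     (\<exists>k\<ge>2. \<exists>P. partition_on (verts D) P \<and> card P = k \<and>
        mk_symmetric D = complete_multipartite_graph P)"

text \<open>
  The digraph \<open>H\<close> as a whole is a directed cycle with \<open>n\<close> vertices (equivalently \<open>n\<close> arcs).
\<close>

definition directed_cycle :: "nat \<Rightarrow> ('a,'b) pre_digraph \<Rightarrow> bool" where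
  "directed_cycle n H \<longleftrightarrow>
     (\<exists>p. pre_digraph.cycle H p \<and> length p = n \<and> arcs H = set p \<and> verts H = tail H ` set p)"

definition directed_hole :: "nat \<Rightarrow> ('a,'b) pre_digraph \<Rightarrow> ('a,'b) pre_digraph \<Rightarrow> bool" where
  "directed_hole n D H \<longleftrightarrow> n \<ge> 4 \<and> directed_cycle n H \<and> induced_subgraph H D"

text \<open>
  Walks are arc lists, so the start vertex \<open>u\<close> is passed along to recover the vertices visited.
\<close>

definition type1_walk :: "('a,'b) pre_digraph \<Rightarrow> 'a \<Rightarrow> 'b awalk \<Rightarrow> 'a \<Rightarrow> bool" where
  "type1_walk D u p w \<longleftrightarrow> pre_digraph.awalk D u p w \<and>
     (\<exists>S \<subseteq> set (pre_digraph.awalk_verts D u p). card S = 3 \<and> directed_cycle 3 (D \<restriction> S))"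

definition type2_walk :: "('a,'b) pre_digraph \<Rightarrow> 'a \<Rightarrow> 'b awalk \<Rightarrow> 'a \<Rightarrow> bool" where
  "type2_walk D u p w \<longleftrightarrow> pre_digraph.awalk D u p w \<and>
     (\<exists>S \<subseteq> set (pre_digraph.awalk_verts D u p). card S = 4 \<and> directed_hole 4 D (D \<restriction> S))"

definition sinks :: "('a,'b) pre_digraph \<Rightarrow> 'a set" where
  "sinks D = {v \<in> verts D. out_degree D v = 0}"

text \<open>
  \<open>elim_digraph D i\<close> is the digraph \<open>D\<^sub>i\<close> and \<open>sink_seq D i\<close> the set \<open>W\<^sub>i\<close>. Both are total
  in \<open>i\<close>, but only the indices up to \<open>sink_elim_index D\<close> (that is, \<open>\<zeta>(D)\<close>) are meaningful:
  this is the first index at which the elimination stops.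
\<close>

primrec elim_digraph :: "('a,'b) pre_digraph \<Rightarrow> nat \<Rightarrow> ('a,'b) pre_digraph" where
  "elim_digraph D 0 = D"
| "elim_digraph D (Suc i) =
     elim_digraph D i \<restriction> (verts (elim_digraph D i) - sinks (elim_digraph D i))"

definition sink_seq :: "('a,'b) pre_digraph \<Rightarrow> nat \<Rightarrow> 'a set" where
  "sink_seq D i = sinks (elim_digraph D i)"

definition sink_elim_index :: "('a,'b) pre_digraph \<Rightarrow> nat" where
  "sink_elim_index D =
     (LEAST i. sink_seq D i = verts (elim_digraph D i) \<or> sink_seq D i = {})"

end

theory Submission
  imports Defs "HOL-Number_Theory.Cong"
begin

text \<open>
  A vertex of a directed cycle is never eliminated, so it dominates every eliminated vertex outside
  its own partite set; of two consecutive vertices of a cycle, one dominates any given eliminated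
  vertex. Likewise the 3-cycle and the 4-cycle supplied by the two walks are joined by an arc, so
  one of them is reached from \<open>u\<close> through the other, and since 3 and 4 are coprime, going around
  both produces walks of every large length from \<open>u\<close> to each vertex of the cycle reached last.
\<close>

section \<open>Nonnegative combinations of coprime lengths\<close>

lemma coprime_nat_combination:
  fixes m n l :: nat
  assumes "coprime m n" "0 < m" "m * n \<le> l"
  shows "\<exists>i j. l = i * m + j * n"
proof -
  obtain x where "[n * x = Suc 0] (mod m)"
    using cong_solve_coprime_nat[of n m] assms(1) by (auto simp: coprime_commute)
  then have "[n * x * l = Suc 0 * l] (mod m)"
    by (rule cong_scalar_right)
  \<comment> \<open>As \<open>x\<close> inverts \<open>n\<close> modulo \<open>m\<close>, this
    residue solves \<open>n * j = l\<close> modulo \<open>m\<close>. Being below \<open>m\<close>,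
    it keeps \<open>n * j\<close> under \<open>m * n \<le> l\<close>, so that the subtraction
    \<open>l - n * j\<close> is not truncated.\<close>
  moreover define j where "j = x * l mod m"
  have "[n * j = n * (x * l)] (mod m)"
    unfolding j_def by (intro cong_scalar_left) (simp add: cong_def)
  ultimately have "[n * j = l] (mod m)"
    by (simp add: cong_def mult.assoc)
  moreover have "j < m"
    using assms(2) by (simp add: j_def)
  then have "n * j \<le> l"
    using assms(3) by (metis less_imp_le mult.commute mult_le_mono2 order_trans)
  ultimately have "m dvd l - n * j"
    by (simp add: cong_altdef_nat cong_sym_eq)
  then obtain i where "l - n * j = m * i" ..
  with \<open>n * j \<le> l\<close> have "l = i * m + j * n"
    by (simp add: mult.commute)
  then show ?thesis by blast
qed

section \<open>Walks of prescribed length as relation powers\<close>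

lemma relpow_comp:
  "(x, y) \<in> R ^^ m \<Longrightarrow> (y, z) \<in> R ^^ n \<Longrightarrow> (x, z) \<in> R ^^ (m + n)"
  by (auto simp: relpow_add)

lemma relpow_closed_power:
  "(x, x) \<in> R ^^ n \<Longrightarrow> (x, x) \<in> R ^^ (k * n)"
  by (induction k) (auto intro: relpow_comp)

text \<open>Moving the first step of a closed walk to its end rotates it to the next vertex.
  Consecutive vertices of a cycle are thus available without naming the cycle.\<close>

lemma relpow_closed_successor:
  assumes "(x, x) \<in> R ^^ n" "0 < n"
  obtains y where "(x, y) \<in> R" "(y, x) \<in> R\<^sup>*" "(y, y) \<in> R ^^ n"
proof -
  obtain k where n: "n = Suc k"
    using assms(2) gr0_implies_Suc by blast
  then obtain y where y: "(x, y) \<in> R" "(y, x) \<in> R ^^ k"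
    using assms(1) relpow_Suc_D2 by metis
  then have "(y, y) \<in> R ^^ n"
    unfolding n by (auto intro: relpow_Suc_I)
  with y show thesis
    using that relpow_imp_rtrancl by blast
qed

lemma eventually_relpow_step:
  assumes "\<forall>\<^sub>F l in sequentially. (x, y) \<in> R ^^ l" "(y, z) \<in> R"
  shows "\<forall>\<^sub>F l in sequentially. (x, z) \<in> R ^^ l"
proof -
  have "\<forall>\<^sub>F l in sequentially. (x, z) \<in> R ^^ Suc l"
    using assms(1) by eventually_elim (use assms(2) in auto)
  then show ?thesis
    by (rule eventually_sequentially_Suc[of "\<lambda>l. (x, z) \<in> R ^^ l", THEN iffD1])
qed

lemma eventually_relpow_rtrancl:
  assumes "\<forall>\<^sub>F l in sequentially. (x, y) \<in> R ^^ l" "(y, z) \<in> R\<^sup>*"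
  shows "\<forall>\<^sub>F l in sequentially. (x, z) \<in> R ^^ l"
  using assms(2,1) by induction (auto intro: eventually_relpow_step)

text \<open>Fix a walk from \<open>u\<close> to \<open>x\<close> of length \<open>a\<close> and one
  from \<open>x\<close> to \<open>y\<close> of length \<open>b\<close>. Inserting \<open>i\<close>
  rounds at \<open>x\<close> and \<open>j\<close> rounds at \<open>y\<close> gives length
  \<open>a + b + i * m + j * n\<close>, which attains every value from \<open>a + b + m * n\<close>
  on.\<close>

lemma eventually_relpow_coprime_closed:
  assumes "(u, x) \<in> R\<^sup>*" "(x, x) \<in> R ^^ m" "(x, y) \<in> R\<^sup>*" "(y, y) \<in> R ^^ n"
    and "coprime m n" "0 < m"
  shows "\<forall>\<^sub>F l in sequentially. (u, y) \<in> R ^^ l"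
proof -
  obtain a b where a: "(u, x) \<in> R ^^ a" and b: "(x, y) \<in> R ^^ b"
    using assms(1,3) by (auto simp: rtrancl_power)
  have "(u, y) \<in> R ^^ l" if "l \<ge> a + b + m * n" for l
  proof -
    obtain i j where "l - (a + b) = i * m + j * n"
      using coprime_nat_combination[OF assms(5,6), of "l - (a + b)"] \<open>l \<ge> _\<close>
      by (metis add_le_imp_le_diff add.commute)
    then have "l = a + (i * m + (b + j * n))"
      using \<open>l \<ge> _\<close> by linarith
    then show ?thesis
      by (simp only: relpow_comp[OF a] relpow_comp[OF _ relpow_comp[OF b]]
          relpow_closed_power[OF assms(2)] relpow_closed_power[OF assms(4)])
  qed
  then show ?thesis
    by (auto simp: eventually_sequentially)
qed

section \<open>Passing between arc lists and relation powers\<close>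

context wf_digraph
begin

lemma awalk_imp_relpow:
  "awalk x p y \<Longrightarrow> (x, y) \<in> arcs_ends G ^^ length p"
proof (induction p arbitrary: x)
  case (Cons e p)
  then have "(x, head G e) \<in> arcs_ends G" "awalk (head G e) p y"
    by (auto simp: awalk_Cons_iff arcs_ends_conv)
  with Cons.IH show ?case
    by (metis relpow_Suc_I2 length_Cons)
qed (auto simp: awalk_Nil_iff)

lemma relpow_imp_awalk:
  assumes "x \<in> verts G" "(x, y) \<in> arcs_ends G ^^ n"
  shows "\<exists>p. awalk x p y \<and> length p = n"
  using assms(2)
proof (induction n arbitrary: y)
  case 0
  then show ?case using assms(1) by (auto simp: awalk_Nil_iff)
next
  case (Suc n)
  then obtain z p e where "awalk x p z" "length p = n" "e \<in> arcs G" "z = tail G e" "y = head G e"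
    by (fastforce simp: arcs_ends_conv)
  then have "awalk x (p @ [e]) y"
    using arc_implies_awalk awalk_appendI by blast
  with \<open>length p = n\<close> show ?case by (metis length_append_singleton)
qed

text \<open>The arc list of the cycle may start elsewhere; cutting it at \<open>x\<close> and
  swapping the two pieces gives a closed walk at \<open>x\<close>.\<close>

lemma directed_cycle_subgraph_relpow:
  assumes "directed_cycle n H" "subgraph H G" "x \<in> verts H"
  shows "(x, x) \<in> arcs_ends G ^^ n"
proof -
  from assms(1) obtain p v where p: "pre_digraph.awalk H v p v" "length p = n"
    and "verts H = tail H ` set p"
    by (auto simp: directed_cycle_def pre_digraph.cycle_def)
  then obtain e where "e \<in> set p" "x = tail G e"
    using assms(2,3) by (auto simp: compatible_tail subgraph_def)
  then have "x \<in> set (awalk_verts v p)"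
    by (simp add: awalk_verts_arc1)
  moreover have "awalk v p v"
    using p(1) assms(2) by (rule subgraph_awalk_imp_awalk)
  ultimately obtain q r where "p = q @ r" "awalk v q x" "awalk x r v"
    using awalk_decomp by blast
  then show ?thesis
    using awalk_imp_relpow[OF awalk_appendI, of x r v q x] p(2) by (simp add: add.commute)
qed

text \<open>Extracts what is used of a walk of either type: every vertex of \<open>S\<close> is
  visited, hence reachable from \<open>u\<close>, and lies on the cycle.\<close>

lemma awalk_through_cycle:
  assumes "awalk u p w" "S \<subseteq> set (awalk_verts u p)" "card S = n" "0 < n"
    and "directed_cycle n (G \<restriction> S)"
  obtains x where "(u, x) \<in> (arcs_ends G)\<^sup>*" "(x, x) \<in> arcs_ends G ^^ n"
proof -
  obtain x where "x \<in> S"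
    using assms(3,4) by fastforce
  moreover have "S \<subseteq> verts G"
    using assms(1,2) by (auto simp: awalk_verts_in_verts awalk_def)
  then have "subgraph (G \<restriction> S) G"
    using induced_induce induced_imp_subgraph by blast
  ultimately have "(x, x) \<in> arcs_ends G ^^ n"
    using directed_cycle_subgraph_relpow[OF assms(5)] by simp
  moreover have "(u, x) \<in> (arcs_ends G)\<^sup>*"
    using assms(2) \<open>x \<in> S\<close>
    by (intro reachable_rtranclI awalk_verts_reachable_from[OF assms(1)]) auto
  ultimately show thesis using that by blast
qed

end

section \<open>Sink elimination\<close>

lemma elim_digraph_simps:
  shows tail_elim_digraph: "tail (elim_digraph D i) = tail D"
    and head_elim_digraph: "head (elim_digraph D i) = head D"
  by (induction i) auto

context fin_digraph
begin

lemma verts_elim_digraph_subset: "verts (elim_digraph G i) \<subseteq> verts G"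
  by (induction i) auto

lemma arcs_elim_digraph:
  "arcs (elim_digraph G i) =
     {e \<in> arcs G. tail G e \<in> verts (elim_digraph G i) \<and> head G e \<in> verts (elim_digraph G i)}"
  by (induction i) (auto simp: elim_digraph_simps)

lemma sink_seq_iff:
  "v \<in> sink_seq G i \<longleftrightarrow> v \<in> verts (elim_digraph G i) \<and>
     (\<forall>x \<in> verts (elim_digraph G i). (v, x) \<notin> arcs_ends G)"
proof -
  \<comment> \<open>The out-degree is a cardinality, which is also zero for infinite sets;
    finiteness turns out-degree zero into the absence of arcs.\<close>
  have "finite (out_arcs (elim_digraph G i) v)"
    by (rule finite_subset[of _ "arcs G"]) (auto simp: out_arcs_def arcs_elim_digraph)
  then show ?thesis
    by (auto simp: sink_seq_def sinks_def out_degree_def out_arcs_def arcs_elim_digraph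
        elim_digraph_simps arcs_ends_conv)
qed

text \<open>The successor \<open>y\<close> of \<open>x\<close> on the closed walk has a closed walk
  of its own, so by induction both are present at stage \<open>i\<close>. The arc to
  \<open>y\<close> then keeps \<open>x\<close> from being a sink there.\<close>

lemma closed_relpow_not_eliminated:
  assumes "(x, x) \<in> arcs_ends G ^^ n" "0 < n"
  shows "x \<in> verts (elim_digraph G i)"
  using assms(1)
proof (induction i arbitrary: x)
  case 0
  then obtain y where "(x, y) \<in> arcs_ends G"
    using relpow_closed_successor assms(2) by metis
  then show ?case by auto
next
  case (Suc i)
  then obtain y where "(x, y) \<in> arcs_ends G" "(y, y) \<in> arcs_ends G ^^ n"
    using relpow_closed_successor assms(2) by metis
  with Suc.IH[of x] Suc.IH[of y] Suc.prems show ?case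
    by (auto simp: sink_seq_iff simp flip: sink_seq_def)
qed

end

section \<open>Adjacency in multipartite tournaments\<close>

lemma multipartite_tournament_digraph: "multipartite_tournament D \<Longrightarrow> digraph D"
  by (simp add: multipartite_tournament_def oriented_graph_def)

text \<open>The ends of an arc lie in different partite sets, so the set containing \<open>v\<close>
  differs from at least one of these.\<close>

lemma multipartite_tournament_adjacent:
  assumes "multipartite_tournament D" "(x, y) \<in> arcs_ends D" "v \<in> verts D"
  obtains z where "z = x \<or> z = y" "(z, v) \<in> arcs_ends D \<or> (v, z) \<in> arcs_ends D"
proof -
  interpret digraph D
    using assms(1) by (rule multipartite_tournament_digraph)
  from assms(1) obtain P where P: "partition_on (verts D) P"
    and "mk_symmetric D = complete_multipartite_graph P"
    by (auto simp: multipartite_tournament_def)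
  moreover have "(a, b) \<in> parcs (mk_symmetric D) \<longleftrightarrow> (a, b) \<in> arcs_ends D \<or> (b, a) \<in> arcs_ends D"
    for a b
    by (auto simp: parcs_mk_symmetric arcs_ends_conv)
  ultimately have adj: "(a, b) \<in> arcs_ends D \<or> (b, a) \<in> arcs_ends D \<longleftrightarrow>
      (\<exists>A\<in>P. \<exists>B\<in>P. A \<noteq> B \<and> a \<in> A \<and> b \<in> B)" for a b
    by (simp add: complete_multipartite_graph_def)
  obtain A B where "A \<in> P" "B \<in> P" "A \<noteq> B" "x \<in> A" "y \<in> B"
    using adj assms(2) by blast
  moreover obtain C where "C \<in> P" "v \<in> C"
    using assms(3) P by (auto simp: partition_on_def)
  ultimately show thesis
    using that adj by metis
qed

text \<open>Whichever of \<open>x\<close> and \<open>y\<close> is adjacent to \<open>w\<close> still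
  exists at stage \<open>i\<close>, where \<open>w\<close> is a sink; the arc between them must
  therefore enter \<open>w\<close>.\<close>

lemma cycle_arc_dominates_eliminated:
  assumes D: "multipartite_tournament D"
    and "(x, x) \<in> arcs_ends D ^^ n" "(y, y) \<in> arcs_ends D ^^ n" "0 < n"
    and "(x, y) \<in> arcs_ends D" and w: "w \<in> sink_seq D i"
  shows "(x, w) \<in> arcs_ends D \<or> (y, w) \<in> arcs_ends D"
proof -
  interpret digraph D
    using D by (rule multipartite_tournament_digraph)
  have "w \<in> verts D"
    using w verts_elim_digraph_subset by (auto simp: sink_seq_iff)
  then obtain z where z: "z = x \<or> z = y" "(z, w) \<in> arcs_ends D \<or> (w, z) \<in> arcs_ends D"
    using multipartite_tournament_adjacent[OF D assms(5)] by metis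
  then have "z \<in> verts (elim_digraph D i)"
    using assms(2-4) closed_relpow_not_eliminated by blast
  with w z show ?thesis
    by (auto simp: sink_seq_iff)
qed

section \<open>Combining the two closed walks\<close>

lemma eventually_relpow_to_eliminated:
  assumes D: "multipartite_tournament D"
    and x: "(u, x) \<in> (arcs_ends D)\<^sup>*" "(x, x) \<in> arcs_ends D ^^ m" "0 < m"
    and y: "(u, y) \<in> (arcs_ends D)\<^sup>*" "(y, y) \<in> arcs_ends D ^^ n" "0 < n"
    and mn: "coprime m n"
  shows "\<forall>\<^sub>F l in sequentially. \<forall>i. \<forall>w \<in> sink_seq D i. (u, w) \<in> arcs_ends D ^^ l"
proof -
  let ?R = "arcs_ends D"
  interpret digraph D
    using D by (rule multipartite_tournament_digraph)
  \<comment> \<open>The bound comes from \<open>b\<close> and its successor alone, so it is uniform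
    in \<open>i\<close> and \<open>w\<close>: once both are reached in exactly \<open>l\<close>
    steps, one more arc reaches any eliminated vertex.\<close>
  have reach: "\<forall>\<^sub>F l in sequentially. \<forall>i. \<forall>w \<in> sink_seq D i. (u, w) \<in> ?R ^^ l"
    if b: "(b, b) \<in> ?R ^^ k" "0 < k" "\<forall>\<^sub>F l in sequentially. (u, b) \<in> ?R ^^ l" for b k
  proof -
    obtain b' where b': "(b, b') \<in> ?R" "(b', b') \<in> ?R ^^ k"
      using relpow_closed_successor b(1,2) by metis
    then have "\<forall>\<^sub>F l in sequentially. (u, b') \<in> ?R ^^ l"
      using eventually_relpow_step[OF b(3)] by simp
    with b(3) have "\<forall>\<^sub>F l in sequentially. \<forall>i. \<forall>w \<in> sink_seq D i. (u, w) \<in> ?R ^^ Suc l"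
    proof eventually_elim
      case (elim l)
      show ?case
      proof (intro allI ballI)
        fix i w
        assume "w \<in> sink_seq D i"
        then have "(b, w) \<in> ?R \<or> (b', w) \<in> ?R"
          using cycle_arc_dominates_eliminated[OF D b(1) b'(2) b(2) b'(1)] by blast
        then show "(u, w) \<in> ?R ^^ Suc l"
          using elim relpow_Suc_I by metis
      qed
    qed
    then show ?thesis
      by (rule eventually_sequentially_Suc[of
            "\<lambda>l. \<forall>i. \<forall>w \<in> sink_seq D i. (u, w) \<in> ?R ^^ l", THEN iffD1])
  qed
  obtain x' where x': "(x, x') \<in> ?R" "(x', x) \<in> ?R\<^sup>*" "(x', x') \<in> ?R ^^ m"
    using relpow_closed_successor x(2,3) by metis
  have "y \<in> verts D"
    using closed_relpow_not_eliminated[OF y(2,3), of 0] by simp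
  \<comment> \<open>Replacing \<open>x\<close> by \<open>z\<close> preserves reachability from
    \<open>u\<close> and the closed length \<open>m\<close>, and makes it adjacent to
    \<open>y\<close>. This also covers \<open>y\<close> lying on the closed walk through
    \<open>x\<close>.\<close>
  then obtain z where "z = x \<or> z = x'" and adj: "(z, y) \<in> ?R \<or> (y, z) \<in> ?R"
    using multipartite_tournament_adjacent[OF D x'(1)] by metis
  then have z: "(u, z) \<in> ?R\<^sup>*" "(z, z) \<in> ?R ^^ m"
    using x x' rtrancl_into_rtrancl[OF x(1) x'(1)] by blast+
  \<comment> \<open>The direction of the arc decides which closed walk is traversed last;
    \<open>reach\<close> is applied to its vertex.\<close>
  from adj show ?thesis
  proof
    assume "(z, y) \<in> ?R"
    then have "\<forall>\<^sub>F l in sequentially. (u, y) \<in> ?R ^^ l"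
      by (intro eventually_relpow_coprime_closed[OF z _ y(2) mn x(3)] r_into_rtrancl)
    with y(2,3) show ?thesis by (rule reach)
  next
    assume "(y, z) \<in> ?R"
    moreover have "coprime n m"
      using mn by (simp add: coprime_commute)
    ultimately have "\<forall>\<^sub>F l in sequentially. (u, z) \<in> ?R ^^ l"
      by (intro eventually_relpow_coprime_closed[OF y(1,2) _ z(2) _ y(3)] r_into_rtrancl)
    with z(2) x(3) show ?thesis by (rule reach)
  qed
qed

theorem lemma3p7:
  fixes D :: "('a,'b) pre_digraph"
    and u w1 w2 :: 'a
    and Q1 Q2 :: "'b awalk"
  assumes "multipartite_tournament D"
    and "\<exists>C. pre_digraph.cycle D C"
    and "sink_elim_index D \<ge> 1"
    and "u \<in> verts (elim_digraph D (sink_elim_index D))"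
    and "w1 \<in> (\<Union>i<sink_elim_index D. sink_seq D i)"
    and "w2 \<in> (\<Union>i<sink_elim_index D. sink_seq D i)"
    and "type1_walk D u Q1 w1"
    and "type2_walk D u Q2 w2"
  shows "\<exists>N::nat. N > 0 \<and>
    (\<forall>w \<in> (\<Union>i<sink_elim_index D. sink_seq D i). \<forall>l\<ge>N.
       \<exists>Q. pre_digraph.awalk D u Q w \<and> length Q = l)"
proof -
  interpret digraph D
    using assms(1) by (rule multipartite_tournament_digraph)
  obtain x where "(u, x) \<in> (arcs_ends D)\<^sup>*" "(x, x) \<in> arcs_ends D ^^ 3"
    using assms(7) awalk_through_cycle[of u Q1 w1 _ 3] unfolding type1_walk_def by auto
  moreover obtain y where "(u, y) \<in> (arcs_ends D)\<^sup>*" "(y, y) \<in> arcs_ends D ^^ 4"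
    using assms(8) awalk_through_cycle[of u Q2 w2 _ 4]
    unfolding type2_walk_def directed_hole_def by auto
  moreover have "coprime 3 (4 :: nat)"
    using coprime_Suc_right_nat[of 3] by simp
  ultimately have "\<forall>\<^sub>F l in sequentially. \<forall>i. \<forall>w \<in> sink_seq D i. (u, w) \<in> arcs_ends D ^^ l"
    using eventually_relpow_to_eliminated[OF assms(1), of u x 3 y 4] by simp
  then obtain N where "\<And>l i w. l \<ge> N \<Longrightarrow> w \<in> sink_seq D i \<Longrightarrow> (u, w) \<in> arcs_ends D ^^ l"
    by (auto simp: eventually_sequentially)
  moreover have "u \<in> verts D"
    using assms(4) verts_elim_digraph_subset by blast
  \<comment> \<open>\<open>Suc N\<close> ensures that the bound is positive.\<close>
  ultimately show ?thesis
    by (intro exI[of _ "Suc N"]) (auto intro!: relpow_imp_awalk)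
qed

end
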